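(* Let $G$ be a finite simple graph on $n\ge1$ vertices with clique number $\omega=\omega(G)$, and let $M=(M_{uv})_{u,v\in V(G)}$ be a doubly nonnegative real matrix indexed by $V(G)$. Then $$2\sum_{uv\in E(G)}\sqrt{M_{uv}}\le\left(1-\frac1\omega\right)n\cdot\sqrt{\sum_{u,v\in V(G)}M_{uv}}.$$
   Context: Graphs are finite and simple. The clique number $\omega(G)$ is the largest number of vertices in a clique of $G$. A real symmetric matrix $M$ is doubly nonnegative if it is positive semidefinite and all of its entries are nonnegative. The sum on the left is over undirected edges, each counted once; the sum on the right is over all ordered pairs $(u,v)\in V(G)\times V(G)$, including $u=v$. *)

theory Defs
  imports "HOL-Analysis.Analysis" "HOL-Library.Ramsey"
begin

text \<open>A finite simple graph is a finite vertex set \<open>V\<close> with a set \<open>E\<close> of two-element subsets of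
  \<open>V\<close>. Cliques are those of \<^theory>\<open>HOL-Library.Ramsey\<close>; the empty set and singletons are cliques.\<close>

definition finite_simple_graph :: "'a set \<Rightarrow> 'a set set \<Rightarrow> bool" where
  "finite_simple_graph V E \<longleftrightarrow> finite V \<and> E \<subseteq> [V]\<^bsup>2\<^esup>"

definition clique_number :: "'a set \<Rightarrow> 'a set set \<Rightarrow> nat" where
  "clique_number V E = Max (card ` {K. K \<subseteq> V \<and> clique K E})"

text \<open>A real matrix indexed by a finite set \<open>V\<close> is a function \<open>M\<close> of two arguments, of which only
  the values on \<open>V \<times> V\<close> matter.\<close>

definition symmetric_matrix_on :: "'a set \<Rightarrow> ('a \<Rightarrow> 'a \<Rightarrow> real) \<Rightarrow> bool" where
  "symmetric_matrix_on V M \<longleftrightarrow> (\<forall>u\<in>V. \<forall>v\<in>V. M u v = M v u)"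

definition psd_matrix_on :: "'a set \<Rightarrow> ('a \<Rightarrow> 'a \<Rightarrow> real) \<Rightarrow> bool" where
  "psd_matrix_on V M \<longleftrightarrow> symmetric_matrix_on V M \<and>
     (\<forall>x :: 'a \<Rightarrow> real. (\<Sum>u\<in>V. \<Sum>v\<in>V. x u * M u v * x v) \<ge> 0)"

definition doubly_nonnegative_on :: "'a set \<Rightarrow> ('a \<Rightarrow> 'a \<Rightarrow> real) \<Rightarrow> bool" where
  "doubly_nonnegative_on V M \<longleftrightarrow> psd_matrix_on V M \<and> (\<forall>u\<in>V. \<forall>v\<in>V. M u v \<ge> 0)"

text \<open>The entry of a symmetric matrix at an undirected edge \<open>{u, v}\<close>: symmetry makes \<open>M u v\<close>
  independent of the order of the endpoints.\<close>

definition edge_entry :: "('a \<Rightarrow> 'a \<Rightarrow> real) \<Rightarrow> 'a set \<Rightarrow> real" where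
  "edge_entry M e = (THE c. \<exists>u v. e = {u, v} \<and> c = M u v)"

lemma edge_entry_eq:
  assumes "M u v = M v u"
  shows "edge_entry M {u, v} = M u v"
  unfolding edge_entry_def using assms by (intro the_equality) (auto simp: doubleton_eq_iff)

end

theory Submission
  imports Defs
begin

text \<open>
  Adding a small multiple of the identity, assume that the diagonal of \<open>M\<close> is positive. Maximise
  \<open>\<Sum>\<^bsub>u \<sim> v\<^esub> sqrt (p\<^sub>u r\<^sub>u M\<^sub>u\<^sub>v r\<^sub>v p\<^sub>v)\<close> over \<open>p, r \<ge> 0\<close> with
  \<open>\<Sum>\<^sub>u p\<^sub>u = 1\<close> and \<open>r\<^sup>T M r = 1\<close>; constant \<open>p\<close> and \<open>r\<close> give the left-hand side of the theorem,
  so it suffices to bound the maximum \<open>\<lambda>\<close> by \<open>1 - 1 / \<omega>\<close>. Stationarity gives \<open>p\<^sub>u = r\<^sub>u a\<^sub>u\<close> with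
  \<open>a = M r\<close>. The matrix \<open>N\<^sub>u\<^sub>v = M\<^sub>u\<^sub>v / (a\<^sub>u a\<^sub>v)\<close> then satisfies \<open>\<Sum>\<^sub>v p\<^sub>v N\<^sub>u\<^sub>v = 1\<close>, it dominates the
  all-ones matrix by the Cauchy-Schwarz inequality, and \<open>\<Sum>\<^bsub>v \<sim> u\<^esub> p\<^sub>v sqrt N\<^sub>u\<^sub>v = \<lambda>\<close> on the support.
  With \<open>2 sqrt N\<^sub>u\<^sub>v \<le> 1 + N\<^sub>u\<^sub>v\<close> the non-neighbours \<open>v\<close> of \<open>u\<close> have
  \<open>\<Sum> p\<^sub>v (1 + N\<^sub>u\<^sub>v) \<le> 2 - 2\<lambda>\<close>. Summing over the vertices of a maximum clique \<open>K\<close> and averaging over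
  all \<open>K\<close> with weight \<open>\<Prod>\<^bsub>w \<in> K\<^esub> p\<^sub>w\<close> makes the left-hand side at least \<open>2\<close>, hence
  \<open>2 \<le> \<omega> (2 - 2\<lambda>)\<close>.
\<close>

section \<open>Cliques and the clique number\<close>

lemma clique_insert_iff:
  "clique (insert u F) E \<longleftrightarrow> clique F E \<and> (\<forall>w\<in>F. w \<noteq> u \<longrightarrow> {u, w} \<in> E)"
  by (auto simp: clique_def insert_commute)

lemma finite_clique_cards: "finite V \<Longrightarrow> finite (card ` {K. K \<subseteq> V \<and> clique K E})"
  by simp

lemma card_le_clique_number:
  assumes "finite V" "K \<subseteq> V" "clique K E"
  shows "card K \<le> clique_number V E"
  unfolding clique_number_def using assms by (intro Max_ge finite_clique_cards) auto

lemma clique_number_attained: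
  assumes "finite V"
  obtains K where "K \<subseteq> V" "clique K E" "card K = clique_number V E"
proof -
  have "{} \<in> {K. K \<subseteq> V \<and> clique K E}" by (auto simp: clique_def)
  then have "clique_number V E \<in> card ` {K. K \<subseteq> V \<and> clique K E}"
    unfolding clique_number_def by (intro Max_in finite_clique_cards assms) blast
  then show ?thesis using that by auto
qed

lemma clique_number_mono:
  assumes "finite V" "W \<subseteq> V"
  shows "clique_number W E \<le> clique_number V E"
proof -
  obtain K where "K \<subseteq> W" "clique K E" "card K = clique_number W E"
    using clique_number_attained finite_subset[OF assms(2,1)] by metis
  then show ?thesis using card_le_clique_number[OF assms(1), of K E] assms(2) by auto
qed

section \<open>Double counting and averaging over maximum cliques\<close>

definition common_nbrs :: "'a set \<Rightarrow> 'a set set \<Rightarrow> 'a set \<Rightarrow> 'a set" where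
  "common_nbrs V E F = {v\<in>V. \<forall>w\<in>F. {v, w} \<in> E}"

text \<open>By maximality of \<open>K\<close>, \<open>v\<close> has a non-neighbour in
  \<open>K\<close>; a vertex of \<open>K\<close> counts as its own non-neighbour since there are no
  loops. If that non-neighbour \<open>a\<close> is the only one, then \<open>v\<close> is adjacent
  to all of \<open>K - {a}\<close>, so \<open>a\<close> is counted by the second set as
  well.\<close>

lemma double_count_max_clique:
  assumes V: "finite V" and loop: "\<And>v. {v} \<notin> E"
    and K: "K \<subseteq> V" "clique K E" "card K = clique_number V E" and v: "v \<in> V"
  shows "2 \<le> card {u\<in>K. {u, v} \<notin> E} + card {u\<in>K. v \<in> common_nbrs V E (K - {u})}"
proof -
  let ?A = "{u\<in>K. {u, v} \<notin> E}" and ?B = "{u\<in>K. v \<in> common_nbrs V E (K - {u})}"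
  have fK: "finite K" using K V finite_subset by blast
  then have fin: "finite ?A" "finite ?B" by auto
  have "?A \<noteq> {}"
  proof
    assume e: "?A = {}"
    then have "v \<notin> K" using loop[of v] by auto
    moreover have "clique (insert v K) E"
      using e K(2) by (auto simp: clique_insert_iff insert_commute)
    ultimately show False
      using card_le_clique_number[OF V, of "insert v K" E] K v fK by auto
  qed
  then obtain a where a: "a \<in> ?A" by auto
  show ?thesis
  proof (cases "?A = {a}")
    case True
    have "{v, w} \<in> E" if w: "w \<in> K - {a}" for w
    proof -
      have "w \<notin> ?A" using w True by blast
      then show ?thesis using w by (simp add: insert_commute)
    qed
    then have "a \<in> ?B" using a v by (auto simp: common_nbrs_def)
    then have "card ?B > 0" using fin by (auto simp: card_gt_0_iff)
    then show ?thesis using True by simp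
  next
    case False
    then obtain b where "b \<in> ?A" "b \<noteq> a" using a by auto
    then have "card {a, b} \<le> card ?A" using a fin by (intro card_mono) auto
    then show ?thesis using \<open>b \<noteq> a\<close> by simp
  qed
qed

text \<open>Otherwise \<open>v\<close> would extend \<open>K\<close>. This places the common
  neighbourhood of \<open>K - {u}\<close> among the non-neighbours of \<open>u\<close>, so its
  entries of \<open>N\<close> are controlled by the bound on non-neighbours.\<close>

lemma common_nbrs_max_clique_nonadjacent:
  assumes V: "finite V" and loop: "\<And>v. {v} \<notin> E"
    and K: "K \<subseteq> V" "clique K E" "card K = clique_number V E"
    and u: "u \<in> K" and v: "v \<in> common_nbrs V E (K - {u})"
  shows "{u, v} \<notin> E"
proof
  assume e: "{u, v} \<in> E"
  have fK: "finite K" using K V finite_subset by blast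
  have adj: "{v, w} \<in> E" if "w \<in> K" for w
    using that e v by (cases "w = u") (auto simp: common_nbrs_def insert_commute)
  then have "v \<notin> K" using loop[of v] by (metis insert_absorb2)
  moreover have "clique (insert v K) E" using adj K(2) by (auto simp: clique_insert_iff)
  ultimately show False
    using card_le_clique_number[OF V, of "insert v K" E] K v fK by (auto simp: common_nbrs_def)
qed

text \<open>Removing the marked vertex is a bijection from pairs (clique \<open>K\<close>, vertex
  \<open>u\<close> of \<open>K\<close>) to pairs (smaller clique \<open>F\<close>, common neighbour
  \<open>u\<close> of \<open>F\<close>), and the product weight of \<open>K\<close> is
  \<open>p u\<close> times that of \<open>F\<close>. Without loops \<open>u\<close> is not in
  \<open>F\<close>, so inserting it again raises the size by one.\<close>

lemma sum_max_cliques_reindex: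
  fixes p :: "'a \<Rightarrow> real" and g :: "'a set \<Rightarrow> 'a \<Rightarrow> real"
  assumes V: "finite V" and loop: "\<And>v. {v} \<notin> E" and k: "k > 0"
  shows "(\<Sum>K | K \<subseteq> V \<and> clique K E \<and> card K = k. (\<Prod>w\<in>K. p w) * (\<Sum>u\<in>K. g (K - {u}) u))
    = (\<Sum>F | F \<subseteq> V \<and> clique F E \<and> card F = k - 1.
         (\<Prod>w\<in>F. p w) * (\<Sum>u\<in>common_nbrs V E F. p u * g F u))"
    (is "(\<Sum>K\<in>?K. _) = (\<Sum>F\<in>?F. _)")
proof -
  have fin: "finite ?K" "finite ?F" using V by auto
  have fK: "finite K" if "K \<subseteq> V" for K using that V finite_subset by blast
  have fI: "finite (common_nbrs V E F)" for F using V by (auto simp: common_nbrs_def)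
  have notin: "u \<notin> F" if "u \<in> common_nbrs V E F" for u F
    using that loop[of u] by (auto simp: common_nbrs_def)
  have "(\<Sum>K\<in>?K. (\<Prod>w\<in>K. p w) * (\<Sum>u\<in>K. g (K - {u}) u))
      = (\<Sum>(K, u)\<in>Sigma ?K (\<lambda>K. K). (\<Prod>w\<in>K. p w) * g (K - {u}) u)"
    using fin fK by (simp add: sum_distrib_left sum.Sigma)
  also have "\<dots> = (\<Sum>(F, u)\<in>Sigma ?F (common_nbrs V E). (\<Prod>w\<in>F. p w) * (p u * g F u))"
  proof (rule sum.reindex_bij_witness[where
        i = "\<lambda>(F, u). (insert u F, u)" and j = "\<lambda>(K, u). (K - {u}, u)"])
    fix a assume "a \<in> Sigma ?K (\<lambda>K. K)"
    then obtain K u where a: "a = (K, u)" "K \<subseteq> V" "clique K E" "card K = k" "u \<in> K" by auto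
    show "(case (case a of (K, u) \<Rightarrow> (K - {u}, u)) of (F, u) \<Rightarrow> (insert u F, u)) = a"
      using a by auto
    show "(case a of (K, u) \<Rightarrow> (K - {u}, u)) \<in> Sigma ?F (common_nbrs V E)"
      using a by (auto simp: common_nbrs_def clique_def)
    show "(case (case a of (K, u) \<Rightarrow> (K - {u}, u)) of
        (F, u) \<Rightarrow> (\<Prod>w\<in>F. p w) * (p u * g F u)) = (case a of (K, u) \<Rightarrow> (\<Prod>w\<in>K. p w) * g (K - {u}) u)"
      using a fK[of K] by (simp add: prod.remove[of K u])
  next
    fix b assume "b \<in> Sigma ?F (common_nbrs V E)"
    then obtain F u where b: "b = (F, u)" "F \<subseteq> V" "clique F E" "card F = k - 1"
      "u \<in> common_nbrs V E F" by auto
    then have u: "u \<notin> F" using notin by auto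
    show "(case (case b of (F, u) \<Rightarrow> (insert u F, u)) of (K, u) \<Rightarrow> (K - {u}, u)) = b"
      using b u by auto
    show "(case b of (F, u) \<Rightarrow> (insert u F, u)) \<in> Sigma ?K (\<lambda>K. K)"
      using b u fK[of F] k by (auto simp: common_nbrs_def clique_insert_iff)
  qed
  also have "\<dots> = (\<Sum>F\<in>?F. (\<Prod>w\<in>F. p w) * (\<Sum>u\<in>common_nbrs V E F. p u * g F u))"
    using fin fI by (simp add: sum_distrib_left sum.Sigma)
  finally show ?thesis .
qed

lemma clique_number_pos:
  assumes "finite V" "V \<noteq> {}"
  shows "clique_number V E > 0"
proof -
  obtain a where "a \<in> V" using assms by auto
  then show ?thesis using card_le_clique_number[of V "{a}" E] assms by (auto simp: clique_def)
qed

text \<open>A vertex with at least two non-neighbours in \<open>K\<close> is counted twice by them. One whose only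
  non-neighbour in \<open>K\<close> is \<open>u\<close> lies in the common neighbourhood of \<open>K - {u}\<close>; there, for each
  fixed \<open>K - {u}\<close>, the entries of \<open>N\<close> average to at least one.\<close>

lemma clique_averaging:
  fixes p :: "'a \<Rightarrow> real" and N :: "'a \<Rightarrow> 'a \<Rightarrow> real"
  assumes V: "finite V" "V \<noteq> {}" and loop: "\<And>v. {v} \<notin> E"
    and p: "\<And>u. u \<in> V \<Longrightarrow> p u > 0"
    and N0: "\<And>u v. u \<in> V \<Longrightarrow> v \<in> V \<Longrightarrow> N u v \<ge> 0"
    and NJ: "\<And>x. (\<Sum>u\<in>V. x u)\<^sup>2 \<le> (\<Sum>u\<in>V. \<Sum>v\<in>V. x u * N u v * x v)"
    and mu: "\<And>u. u \<in> V \<Longrightarrow> (\<Sum>v | v \<in> V \<and> {u, v} \<notin> E. p v * (1 + N u v)) \<le> \<mu>"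
  shows "2 * (\<Sum>v\<in>V. p v) \<le> real (clique_number V E) * \<mu>"
proof -
  let ?k = "clique_number V E"
  let ?K = "{K. K \<subseteq> V \<and> clique K E \<and> card K = ?k}"
  let ?F = "{F. F \<subseteq> V \<and> clique F E \<and> card F = ?k - 1}"
  let ?I = "common_nbrs V E"
  define P where "P = (\<Sum>v\<in>V. p v)"
  define pp where "pp K = (\<Prod>w\<in>K. p w)" for K
  \<comment> \<open>The surplus of row \<open>u\<close> of \<open>N\<close> over the all-ones row,
    weighted by \<open>p\<close> on the common neighbourhood of \<open>F\<close>. A single value may
    be negative; only its average over \<open>u\<close> is controlled.\<close>
  define g where "g F u = (\<Sum>v\<in>?I F. p v * (N u v - 1))" for F u
  have fin: "finite ?K" "finite ?F" using V by auto
  have IV: "?I F \<subseteq> V" for F by (auto simp: common_nbrs_def)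
  have pp: "pp K > 0" if "K \<subseteq> V" for K
    unfolding pp_def using that p by (intro prod_pos) auto
  \<comment> \<open>Sum the row bounds over \<open>u\<close> in \<open>K\<close>. The entries of
    \<open>N\<close> are dropped outside the common neighbourhood of \<open>K - {u}\<close>, and
    inside it are written as 1 plus the surplus; the ones then add up to at least
    \<open>2 * P\<close> by double counting.\<close>
  have local: "2 * P + (\<Sum>u\<in>K. g (K - {u}) u) \<le> real ?k * \<mu>" if K: "K \<in> ?K" for K
  proof -
    have fK: "finite K" using K V finite_subset by blast
    have "(\<Sum>v | v \<in> V \<and> {u, v} \<notin> E. p v) + (\<Sum>v\<in>?I (K - {u}). p v) + g (K - {u}) u \<le> \<mu>"
      if u: "u \<in> K" for u
    proof -
      have sub: "?I (K - {u}) \<subseteq> {v\<in>V. {u, v} \<notin> E}"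
      proof
        fix v assume v: "v \<in> ?I (K - {u})"
        have "{u, v} \<notin> E"
          by (rule common_nbrs_max_clique_nonadjacent[OF V(1) loop _ _ _ u v]) (use K in auto)
        then show "v \<in> {v\<in>V. {u, v} \<notin> E}" using v IV by auto
      qed
      have "(\<Sum>v\<in>?I (K - {u}). p v * N u v) \<le> (\<Sum>v | v \<in> V \<and> {u, v} \<notin> E. p v * N u v)"
      proof (rule sum_mono2)
        fix v assume "v \<in> {v \<in> V. {u, v} \<notin> E} - ?I (K - {u})"
        then show "0 \<le> p v * N u v" using N0[of u v] p[of v] u K by auto
      qed (use V sub in auto)
      moreover have "(\<Sum>v | v \<in> V \<and> {u, v} \<notin> E. p v * (1 + N u v)) \<le> \<mu>"
        using mu u K by blast
      ultimately show ?thesis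
        by (simp add: g_def algebra_simps sum.distrib sum_subtractf)
    qed
    then have "(\<Sum>u\<in>K. (\<Sum>v | v \<in> V \<and> {u, v} \<notin> E. p v) + (\<Sum>v\<in>?I (K - {u}). p v)
        + g (K - {u}) u) \<le> (\<Sum>u\<in>K. \<mu>)"
      by (intro sum_mono)
    moreover have "(\<Sum>u\<in>K. \<Sum>v | v \<in> V \<and> {u, v} \<notin> E. p v)
        = (\<Sum>v\<in>V. p v * card {u\<in>K. {u, v} \<notin> E})"
    proof -
      have "(\<Sum>u\<in>K. \<Sum>v | v \<in> V \<and> {u, v} \<notin> E. p v)
          = (\<Sum>v\<in>V. \<Sum>u | u \<in> K \<and> {u, v} \<notin> E. p v)"
        using fK V(1) by (rule sum.swap_restrict)
      then show ?thesis by (simp add: mult.commute)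
    qed
    moreover have "(\<Sum>u\<in>K. \<Sum>v\<in>?I (K - {u}). p v)
        = (\<Sum>v\<in>V. p v * card {u\<in>K. v \<in> ?I (K - {u})})"
    proof -
      have "(\<Sum>u\<in>K. \<Sum>v\<in>?I (K - {u}). p v) = (\<Sum>u\<in>K. \<Sum>v | v \<in> V \<and> v \<in> ?I (K - {u}). p v)"
        using IV by (intro sum.cong refl) blast
      also have "\<dots> = (\<Sum>v\<in>V. \<Sum>u | u \<in> K \<and> v \<in> ?I (K - {u}). p v)"
        using fK V(1) by (intro sum.swap_restrict)
      finally show ?thesis by (simp add: mult.commute)
    qed
    moreover have "2 * P \<le> (\<Sum>v\<in>V. p v * card {u\<in>K. {u, v} \<notin> E})
        + (\<Sum>v\<in>V. p v * card {u\<in>K. v \<in> ?I (K - {u})})"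
      unfolding P_def sum_distrib_left sum.distrib[symmetric]
    proof (rule sum_mono)
      fix v assume v: "v \<in> V"
      have "real 2 \<le> real (card {u\<in>K. {u, v} \<notin> E} + card {u\<in>K. v \<in> ?I (K - {u})})"
        using double_count_max_clique[OF V(1) loop _ _ _ v] K by (intro of_nat_mono) blast
      then have "p v * 2 \<le> p v * (real (card {u\<in>K. {u, v} \<notin> E}) + real (card {u\<in>K. v \<in> ?I (K - {u})}))"
        using p[OF v] by (intro mult_left_mono) auto
      then show "2 * p v \<le> p v * card {u\<in>K. {u, v} \<notin> E} + p v * card {u\<in>K. v \<in> ?I (K - {u})}"
        by (simp add: algebra_simps)
    qed
    ultimately show ?thesis using K by (simp add: sum.distrib)
  qed
  \<comment> \<open>Apply \<open>NJ\<close> to \<open>p\<close> cut off outside the common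
    neighbourhood: the sum is the quadratic form of \<open>N\<close> minus the squared
    total.\<close>
  have gain: "0 \<le> (\<Sum>u\<in>?I F. p u * g F u)" for F
  proof -
    let ?x = "\<lambda>u. if u \<in> ?I F then p u else 0"
    have fI: "finite (?I F)" using V IV finite_subset by blast
    have s: "(\<Sum>u\<in>V. if u \<in> ?I F then h u else 0) = (\<Sum>u\<in>?I F. h u)" for h :: "'a \<Rightarrow> real"
      using V IV[of F] by (simp add: sum.If_cases Int_absorb1)
    have "(\<Sum>u\<in>V. \<Sum>v\<in>V. ?x u * N u v * ?x v)
        = (\<Sum>u\<in>V. if u \<in> ?I F then (\<Sum>v\<in>V. if v \<in> ?I F then p u * N u v * p v else 0) else 0)"
      by (intro sum.cong refl) (auto intro!: sum.cong sum.neutral)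
    also have "\<dots> = (\<Sum>u\<in>?I F. \<Sum>v\<in>?I F. p u * N u v * p v)" by (simp only: s)
    finally have "(\<Sum>u\<in>?I F. p u)\<^sup>2 \<le> (\<Sum>u\<in>?I F. \<Sum>v\<in>?I F. p u * N u v * p v)"
      using NJ[of ?x] by (simp only: s)
    then show ?thesis
      by (simp add: g_def power2_eq_square sum_product sum_distrib_left algebra_simps sum_subtractf)
  qed
  \<comment> \<open>Regrouping the surpluses by \<open>F = K - {u}\<close> shows that their weighted
    sum over maximum cliques is nonnegative, so the local inequalities survive averaging without the
    surplus term.\<close>
  have "0 \<le> (\<Sum>F\<in>?F. pp F * (\<Sum>u\<in>?I F. p u * g F u))"
  proof (rule sum_nonneg)
    fix F assume "F \<in> ?F"
    then have "pp F > 0" using pp by blast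
    then show "0 \<le> pp F * (\<Sum>u\<in>?I F. p u * g F u)" using gain[of F] by simp
  qed
  also have "\<dots> = (\<Sum>K\<in>?K. pp K * (\<Sum>u\<in>K. g (K - {u}) u))"
    unfolding pp_def
    using sum_max_cliques_reindex[OF V(1) loop clique_number_pos[OF V], where p=p and g=g] by simp
  also have "\<dots> \<le> (\<Sum>K\<in>?K. pp K * (real ?k * \<mu> - 2 * P))"
  proof (rule sum_mono)
    fix K assume K: "K \<in> ?K"
    then have "pp K > 0" using pp by blast
    then show "pp K * (\<Sum>u\<in>K. g (K - {u}) u) \<le> pp K * (real ?k * \<mu> - 2 * P)"
      using local[OF K] by (intro mult_left_mono) auto
  qed
  also have "\<dots> = (\<Sum>K\<in>?K. pp K) * (real ?k * \<mu> - 2 * P)" by (simp add: sum_distrib_right)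
  finally have "0 \<le> (\<Sum>K\<in>?K. pp K) * (real ?k * \<mu> - 2 * P)" .
  moreover have "(\<Sum>K\<in>?K. pp K) > 0"
  proof -
    obtain K where "K \<subseteq> V" "clique K E" "card K = ?k"
      by (rule clique_number_attained[OF V(1)])
    then have "?K \<noteq> {}" by blast
    then show ?thesis using fin(1) pp by (intro sum_pos) auto
  qed
  ultimately show ?thesis by (simp add: P_def zero_le_mult_iff)
qed

section \<open>Quadratic forms and the Cauchy-Schwarz inequality\<close>

definition quad_form :: "'a set \<Rightarrow> ('a \<Rightarrow> 'a \<Rightarrow> real) \<Rightarrow> ('a \<Rightarrow> real) \<Rightarrow> real" where
  "quad_form V A x = (\<Sum>u\<in>V. \<Sum>v\<in>V. x u * A u v * x v)"

lemma quad_form_cong: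
  "(\<And>u. u \<in> V \<Longrightarrow> x u = y u) \<Longrightarrow> quad_form V A x = quad_form V A y"
  unfolding quad_form_def by (intro sum.cong refl) auto

lemma quad_form_scale: "quad_form V A (\<lambda>u. c * x u) = c\<^sup>2 * quad_form V A x"
  by (simp add: quad_form_def sum_distrib_left power2_eq_square mult_ac)

lemma quad_form_add:
  assumes "symmetric_matrix_on V A"
  shows "quad_form V A (\<lambda>u. x u + t * y u)
    = quad_form V A x + 2 * t * (\<Sum>u\<in>V. \<Sum>v\<in>V. y u * A u v * x v) + t\<^sup>2 * quad_form V A y"
proof -
  have "(\<Sum>u\<in>V. \<Sum>v\<in>V. x u * A u v * y v) = (\<Sum>v\<in>V. \<Sum>u\<in>V. x u * A u v * y v)"
    by (rule sum.swap)
  also have "\<dots> = (\<Sum>u\<in>V. \<Sum>v\<in>V. y u * A u v * x v)"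
    using assms by (intro sum.cong refl) (auto simp: symmetric_matrix_on_def)
  finally have "(\<Sum>u\<in>V. \<Sum>v\<in>V. x u * A u v * y v) = (\<Sum>u\<in>V. \<Sum>v\<in>V. y u * A u v * x v)" .
  moreover have "quad_form V A (\<lambda>u. x u + t * y u) = quad_form V A x
      + t * (\<Sum>u\<in>V. \<Sum>v\<in>V. x u * A u v * y v) + t * (\<Sum>u\<in>V. \<Sum>v\<in>V. y u * A u v * x v)
      + t\<^sup>2 * quad_form V A y"
    by (simp add: quad_form_def sum_distrib_left sum.distrib[symmetric] algebra_simps power2_eq_square)
  ultimately show ?thesis by simp
qed

lemma quad_form_scale_entry:
  assumes V: "finite V" "w \<in> V" and A: "symmetric_matrix_on V A"
  shows "quad_form V A (x(w := (1 + t) * x w))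
    = quad_form V A x + 2 * t * (x w * (\<Sum>v\<in>V. A w v * x v)) + t\<^sup>2 * ((x w)\<^sup>2 * A w w)"
proof -
  \<comment> \<open>Scaling one coordinate by \<open>1 + t\<close> means adding \<open>t\<close>
    times the part of \<open>x\<close> supported at \<open>w\<close>.\<close>
  let ?y = "\<lambda>u. if u = w then x w else 0"
  have eq: "x(w := (1 + t) * x w) = (\<lambda>u. x u + t * ?y u)" by (auto simp: algebra_simps)
  have row: "(\<Sum>u\<in>V. \<Sum>v\<in>V. ?y u * A u v * z v) = x w * (\<Sum>v\<in>V. A w v * z v)" for z
  proof -
    have "(\<Sum>u\<in>V. \<Sum>v\<in>V. ?y u * A u v * z v)
        = (\<Sum>u\<in>V. if u = w then x w * (\<Sum>v\<in>V. A w v * z v) else 0)"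
      by (intro sum.cong refl) (auto simp: sum_distrib_left mult_ac)
    then show ?thesis using V by simp
  qed
  have "quad_form V A ?y = (x w)\<^sup>2 * A w w"
    unfolding quad_form_def row using V by (simp add: if_distrib power2_eq_square mult_ac cong: if_cong)
  then show ?thesis unfolding eq quad_form_add[OF A] row by simp
qed

lemma psd_matrix_on_iff:
  "psd_matrix_on V A \<longleftrightarrow> symmetric_matrix_on V A \<and> (\<forall>x. quad_form V A x \<ge> 0)"
  by (simp add: psd_matrix_on_def quad_form_def)

text \<open>The form at \<open>x + t * y\<close> is a nonnegative polynomial in \<open>t\<close>. It
  is evaluated at its minimiser if its leading coefficient is positive; otherwise it is affine,
  which forces its slope to vanish.\<close>

lemma quad_form_Cauchy_Schwarz:
  assumes A: "psd_matrix_on V A"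
  shows "(\<Sum>u\<in>V. \<Sum>v\<in>V. y u * A u v * x v)\<^sup>2 \<le> quad_form V A y * quad_form V A x"
proof -
  define b where "b = (\<Sum>u\<in>V. \<Sum>v\<in>V. y u * A u v * x v)"
  have sym: "symmetric_matrix_on V A" and nonneg: "\<And>z. 0 \<le> quad_form V A z"
    using A by (auto simp: psd_matrix_on_iff)
  have pos: "0 \<le> quad_form V A x + 2 * t * b + t\<^sup>2 * quad_form V A y" for t
    using nonneg[of "\<lambda>u. x u + t * y u"] by (simp add: quad_form_add[OF sym] b_def)
  have y0: "quad_form V A y \<ge> 0" by (rule nonneg)
  show ?thesis
  proof (cases "quad_form V A y = 0")
    case True
    have "b = 0"
    proof (rule ccontr)
      assume "b \<noteq> 0"
      \<comment> \<open>At this \<open>t\<close> the affine function takes the value -1.\<close>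
      then show False using pos[of "- (quad_form V A x + 1) / (2 * b)"] True by (simp add: field_simps)
    qed
    then show ?thesis using True by (simp add: b_def)
  next
    case False
    then have "0 < quad_form V A y" using y0 by simp
    then have "b\<^sup>2 \<le> quad_form V A y * quad_form V A x"
      using pos[of "- b / quad_form V A y"] by (simp add: field_simps power2_eq_square)
    then show ?thesis by (simp add: b_def)
  qed
qed

section \<open>The extremal problem: existence and stationarity of a maximiser\<close>

text \<open>A first-order condition without derivatives. Take \<open>s = b / d\<close> with
  \<open>d\<close> larger than both \<open>\<bar>b\<bar>\<close> and \<open>c\<close>: this
  \<open>s\<close> is admissible, and the inequality fails unless \<open>b = 0\<close>.\<close>

lemma linear_le_quadratic_imp_zero:
  fixes b c :: real
  assumes "\<And>s. \<bar>s\<bar> < 1 \<Longrightarrow> b * s \<le> c * s\<^sup>2"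
  shows "b = 0"
proof (rule ccontr)
  assume b: "b \<noteq> 0"
  define d where "d = 1 + \<bar>b\<bar> + \<bar>c\<bar>"
  have d: "d > 0" "\<bar>b\<bar> < d" "c < d" by (auto simp: d_def)
  have "b * (b / d) \<le> c * (b / d)\<^sup>2" using d by (intro assms) (simp add: abs_divide)
  then have "b\<^sup>2 * d \<le> c * b\<^sup>2" using d by (simp add: field_simps power2_eq_square)
  moreover have "b\<^sup>2 * c < b\<^sup>2 * d" using b d by (intro mult_strict_left_mono) auto
  ultimately show False by (simp add: mult.commute)
qed

text \<open>Tychonoff's theorem. The box consists of functions on the whole type, which need not be
  finite.\<close>

lemma compact_box_fun:
  fixes c :: "'a \<Rightarrow> real"
  shows "compact (PiE UNIV (\<lambda>u. {0..c u}))"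
proof -
  have "compactin (product_topology (\<lambda>i::'a. euclidean :: real topology) UNIV) (PiE UNIV (\<lambda>u. {0..c u}))"
    by (simp add: compactin_PiE)
  then show ?thesis by (simp add: euclidean_product_topology)
qed

text \<open>All terms of the form are nonnegative. With a positive diagonal this bounds each
  \<open>r u\<close>, which makes the extremal problem compact.\<close>

lemma diagonal_le_quad_form:
  assumes V: "finite V" "u \<in> V" and M0: "\<And>u v. u \<in> V \<Longrightarrow> v \<in> V \<Longrightarrow> M u v \<ge> 0"
    and r: "\<And>u. u \<in> V \<Longrightarrow> r u \<ge> 0"
  shows "r u * M u u * r u \<le> quad_form V M r"
proof -
  have "r u * M u u * r u \<le> (\<Sum>v\<in>V. r u * M u v * r v)"
    using V r M0 by (intro member_le_sum[of u V "\<lambda>v. r u * M u v * r v"]) auto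
  also have "\<dots> \<le> quad_form V M r" unfolding quad_form_def
    using V r M0
    by (intro member_le_sum[of u V "\<lambda>u. \<Sum>v\<in>V. r u * M u v * r v"]) (auto intro!: sum_nonneg)
  finally show ?thesis .
qed

definition normalized_pair ::
    "'a set \<Rightarrow> ('a \<Rightarrow> 'a \<Rightarrow> real) \<Rightarrow> ('a \<Rightarrow> real) \<Rightarrow> ('a \<Rightarrow> real) \<Rightarrow> bool" where
  "normalized_pair V M p r \<longleftrightarrow>
    (\<forall>u\<in>V. p u \<ge> 0 \<and> r u \<ge> 0) \<and> (\<Sum>u\<in>V. p u) = 1 \<and> quad_form V M r = 1"

text \<open>The constraints force \<open>p u\<close> to be at most 1 and \<open>r u\<close> at most
  \<open>1 / sqrt (M u u)\<close>. Setting both functions to 0 off \<open>V\<close> changes no sum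
  over \<open>V\<close>, so it suffices to maximise a continuous function over a compact
  set.\<close>

lemma quad_form_attains_max:
  assumes V: "finite V" "V \<noteq> {}"
    and M0: "\<And>u v. u \<in> V \<Longrightarrow> v \<in> V \<Longrightarrow> M u v \<ge> 0" and diag: "\<And>u. u \<in> V \<Longrightarrow> M u u > 0"
  obtains p r :: "'a \<Rightarrow> real" where "normalized_pair V M p r"
    "\<And>p' r'. normalized_pair V M p' r' \<Longrightarrow>
      quad_form V A (\<lambda>u. sqrt (p' u * r' u)) \<le> quad_form V A (\<lambda>u. sqrt (p u * r u))"
proof -
  define c1 :: "'a \<Rightarrow> real" where "c1 u = (if u \<in> V then 1 else 0)" for u
  define c2 :: "'a \<Rightarrow> real" where "c2 u = (if u \<in> V then 1 / sqrt (M u u) else 0)" for u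
  define B where "B = PiE UNIV (\<lambda>u. {0..c1 u}) \<times> PiE UNIV (\<lambda>u. {0..c2 u})"
  define C where "C = {z :: ('a \<Rightarrow> real) \<times> ('a \<Rightarrow> real). (\<Sum>u\<in>V. fst z u) = 1} \<inter> {z. quad_form V M (snd z) = 1}"
  have coord [continuous_intros]: "continuous_on UNIV (\<lambda>z :: ('a \<Rightarrow> real) \<times> ('a \<Rightarrow> real). fst z u)"
    "continuous_on UNIV (\<lambda>z :: ('a \<Rightarrow> real) \<times> ('a \<Rightarrow> real). snd z u)" for u
    by (rule continuous_on_product_then_coordinatewise, intro continuous_intros)+
  have "closed C" unfolding C_def quad_form_def
    by (intro closed_Int closed_Collect_eq continuous_intros)
  then have "compact (B \<inter> C)" unfolding B_def
    by (intro compact_Int_closed compact_Times compact_box_fun)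
  moreover have in_BC: "(\<lambda>u. if u \<in> V then p u else 0, \<lambda>u. if u \<in> V then r u else 0) \<in> B \<inter> C"
    if pr: "normalized_pair V M p r" for p r
  proof -
    have p: "\<And>u. u \<in> V \<Longrightarrow> p u \<ge> 0" and r: "\<And>u. u \<in> V \<Longrightarrow> r u \<ge> 0"
      and p1: "(\<Sum>u\<in>V. p u) = 1" and r1: "quad_form V M r = 1"
      using pr by (auto simp: normalized_pair_def)
    have "p u \<le> 1" if "u \<in> V" for u
      using member_le_sum[of u V p] that p V p1 by auto
    moreover have "r u \<le> 1 / sqrt (M u u)" if u: "u \<in> V" for u
    proof -
      have "r u * M u u * r u \<le> quad_form V M r"
        by (rule diagonal_le_quad_form[where r = r]) (use u V r M0 in auto)
      then have "(r u * sqrt (M u u))\<^sup>2 \<le> 1\<^sup>2"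
        using r1 diag[OF u] by (simp add: power_mult_distrib power2_eq_square mult_ac)
      then have "r u * sqrt (M u u) \<le> 1" by (rule power2_le_imp_le) simp
      then show ?thesis using diag[OF u] by (simp add: field_simps)
    qed
    moreover have "quad_form V M (\<lambda>u. if u \<in> V then r u else 0) = 1"
      using r1 by (subst quad_form_cong[where y = r]) auto
    ultimately show ?thesis using p r p1 by (auto simp: B_def C_def c1_def c2_def)
  qed
  have "B \<inter> C \<noteq> {}"
  proof -
    \<comment> \<open>Suitably scaled constant functions are a feasible pair; the positive diagonal
      makes \<open>s\<close> positive.\<close>
    define s where "s = quad_form V M (\<lambda>_. 1)"
    have row: "(\<Sum>v\<in>V. M u v) > 0" if "u \<in> V" for u
      using that V M0 diag by (intro sum_pos2[of V u]) auto
    have s: "s > 0" unfolding s_def quad_form_def using V row by (simp add: sum_pos)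
    have "quad_form V M (\<lambda>_. 1 / sqrt s * 1) = 1"
      using s by (simp only: quad_form_scale) (simp add: s_def power_divide)
    then show ?thesis
      using in_BC[of "\<lambda>_. 1 / real (card V)" "\<lambda>_. 1 / sqrt s"] s V
      by (simp add: normalized_pair_def, blast)
  qed
  moreover have "continuous_on (B \<inter> C) (\<lambda>z. quad_form V A (\<lambda>u. sqrt (fst z u * snd z u)))"
    unfolding quad_form_def
    by (rule continuous_on_subset[OF _ subset_UNIV]) (intro continuous_intros)
  ultimately have "\<exists>z\<in>B \<inter> C. \<forall>z'\<in>B \<inter> C.
      quad_form V A (\<lambda>u. sqrt (fst z' u * snd z' u)) \<le> quad_form V A (\<lambda>u. sqrt (fst z u * snd z u))"
    by (intro continuous_attains_sup)
  then obtain z where z: "z \<in> B \<inter> C" and max: "\<And>z'. z' \<in> B \<inter> C \<Longrightarrow>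
      quad_form V A (\<lambda>u. sqrt (fst z' u * snd z' u)) \<le> quad_form V A (\<lambda>u. sqrt (fst z u * snd z u))"
    by auto
  show ?thesis
  proof (rule that[of "fst z" "snd z"])
    show "normalized_pair V M (fst z) (snd z)"
      using z by (auto simp: normalized_pair_def B_def C_def PiE_def Pi_def mem_Times_iff)
    fix p' r' :: "'a \<Rightarrow> real" assume h: "normalized_pair V M p' r'"
    have "quad_form V A (\<lambda>u. sqrt (p' u * r' u)) = quad_form V A
        (\<lambda>u. sqrt ((if u \<in> V then p' u else 0) * (if u \<in> V then r' u else 0)))"
      by (rule quad_form_cong) auto
    also have "\<dots> \<le> quad_form V A (\<lambda>u. sqrt (fst z u * snd z u))"
      using max[OF in_BC[OF h]] by simp
    finally show "quad_form V A (\<lambda>u. sqrt (p' u * r' u)) \<le> quad_form V A (\<lambda>u. sqrt (fst z u * snd z u))" .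
  qed
qed

text \<open>Multiplying a single \<open>p\<^sub>w\<close> or \<open>r\<^sub>w\<close> by \<open>(1 + s)\<^sup>2\<close> keeps the square roots polynomial in \<open>s\<close>, so
  stationarity follows from comparing linear terms, also when \<open>p\<^sub>w\<close> or \<open>r\<^sub>w\<close> vanishes.\<close>

lemma quad_form_stationary_max:
  fixes M A :: "'a \<Rightarrow> 'a \<Rightarrow> real"
  assumes V: "finite V" "V \<noteq> {}"
    and M: "symmetric_matrix_on V M" and M0: "\<And>u v. u \<in> V \<Longrightarrow> v \<in> V \<Longrightarrow> M u v \<ge> 0"
    and diag: "\<And>u. u \<in> V \<Longrightarrow> M u u > 0"
    and A: "symmetric_matrix_on V A" and A0: "\<And>u v. u \<in> V \<Longrightarrow> v \<in> V \<Longrightarrow> A u v \<ge> 0"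
    and A_diag: "\<And>u. u \<in> V \<Longrightarrow> A u u = 0"
  obtains p r :: "'a \<Rightarrow> real" and lam where "normalized_pair V M p r"
    "\<And>p' r'. normalized_pair V M p' r' \<Longrightarrow>
      quad_form V A (\<lambda>u. sqrt (p' u * r' u)) \<le> lam"
    "\<And>u. u \<in> V \<Longrightarrow> sqrt (p u * r u) * (\<Sum>v\<in>V. A u v * sqrt (p v * r v)) = lam * p u"
    "\<And>u. u \<in> V \<Longrightarrow> sqrt (p u * r u) * (\<Sum>v\<in>V. A u v * sqrt (p v * r v))
      = lam * (r u * (\<Sum>v\<in>V. M u v * r v))"
proof -
  obtain p r :: "'a \<Rightarrow> real" where pr: "normalized_pair V M p r"
    and max: "\<And>p' r'. normalized_pair V M p' r' \<Longrightarrow>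
      quad_form V A (\<lambda>u. sqrt (p' u * r' u)) \<le> quad_form V A (\<lambda>u. sqrt (p u * r u))"
    by (rule quad_form_attains_max[OF V, of M A]) (erule (1) M0 | erule diag | blast)+
  have p: "\<And>u. u \<in> V \<Longrightarrow> p u \<ge> 0" and r: "\<And>u. u \<in> V \<Longrightarrow> r u \<ge> 0"
    and p1: "(\<Sum>u\<in>V. p u) = 1" and r1: "quad_form V M r = 1"
    using pr by (auto simp: normalized_pair_def)
  define x where "x u = sqrt (p u * r u)" for u
  define lam where "lam = quad_form V A x"
  have lam0: "lam \<ge> 0"
    unfolding lam_def quad_form_def x_def using p r A0
    by (intro sum_nonneg mult_nonneg_nonneg) auto
  \<comment> \<open>Maximality in homogeneous form: the objective has degree 1 in \<open>p'\<close>
    and in \<open>r'\<close>, so perturbed vectors need no normalisation later.\<close>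
  have hom: "quad_form V A (\<lambda>u. sqrt (p' u * r' u)) \<le> lam * (\<Sum>u\<in>V. p' u) * sqrt (quad_form V M r')"
    if p': "\<And>u. u \<in> V \<Longrightarrow> p' u \<ge> 0" and r': "\<And>u. u \<in> V \<Longrightarrow> r' u \<ge> 0"
      and P: "(\<Sum>u\<in>V. p' u) > 0" and Q: "quad_form V M r' > 0" for p' r'
  proof -
    define P where "P = (\<Sum>u\<in>V. p' u)"
    define q where "q = sqrt (quad_form V M r')"
    have pos: "P > 0" "q > 0" using P Q by (auto simp: P_def q_def)
    have qq: "q\<^sup>2 = quad_form V M r'" using Q by (simp add: q_def)
    have "quad_form V M (\<lambda>u. 1 / q * r' u) = 1"
      unfolding quad_form_scale using pos qq[symmetric] by (simp add: power_divide)
    moreover have "(\<Sum>u\<in>V. p' u / P) = 1"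
      using pos by (simp add: sum_divide_distrib[symmetric] P_def[symmetric])
    ultimately have "quad_form V A (\<lambda>u. sqrt (p' u / P * (1 / q * r' u))) \<le> lam"
      unfolding lam_def x_def using pos p' r' by (intro max) (auto simp: normalized_pair_def)
    also have "(\<lambda>u. sqrt (p' u / P * (1 / q * r' u))) = (\<lambda>u. 1 / sqrt (P * q) * sqrt (p' u * r' u))"
      by (simp add: real_sqrt_mult real_sqrt_divide)
    finally have "quad_form V A (\<lambda>u. sqrt (p' u * r' u)) / (P * q) \<le> lam"
      unfolding quad_form_scale using pos by (simp add: power_divide)
    then show ?thesis using pos by (simp add: P_def[symmetric] q_def[symmetric] field_simps)
  qed
  \<comment> \<open>The zero diagonal of \<open>A\<close> removes the term quadratic in
    \<open>s\<close>.\<close>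
  have scaled: "quad_form V A (x(w := (1 + s) * x w))
      = lam + 2 * s * (x w * (\<Sum>v\<in>V. A w v * x v))" if "w \<in> V" for w s
    using quad_form_scale_entry[OF V(1) that A] A_diag[OF that] by (simp add: lam_def)
  have stat_p: "x w * (\<Sum>v\<in>V. A w v * x v) = lam * p w" if w: "w \<in> V" for w
  proof -
    define b where "b = x w * (\<Sum>v\<in>V. A w v * x v)"
    have "2 * (b - lam * p w) = 0"
    proof (rule linear_le_quadratic_imp_zero)
      fix s :: real assume s: "\<bar>s\<bar> < 1"
      define p' where "p' = p(w := (1 + s)\<^sup>2 * p w)"
      have k: "(1 + s)\<^sup>2 > 0" using s by (intro zero_less_power) auto
      have "(\<Sum>u\<in>V. p' u) = (1 + s)\<^sup>2 * p w + (\<Sum>u\<in>V - {w}. p u)"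
        using V w by (simp add: p'_def sum.remove[of V w])
      moreover have "(\<Sum>u\<in>V - {w}. p u) = 1 - p w" using p1 V w by (simp add: sum_diff1)
      ultimately have sum: "(\<Sum>u\<in>V. p' u) = (1 + s)\<^sup>2 * p w + (1 - p w)" by simp
      have "p w \<le> 1" using member_le_sum[of w V p] w p V p1 by auto
      then have P: "(\<Sum>u\<in>V. p' u) > 0"
        unfolding sum using p[OF w] k by (cases "p w = 0") (auto intro!: add_pos_nonneg)
      have eq: "(\<lambda>u. sqrt (p' u * r u)) = x(w := (1 + s) * x w)"
        using s by (auto simp: p'_def x_def real_sqrt_mult)
      have "quad_form V A (\<lambda>u. sqrt (p' u * r u)) \<le> lam * (\<Sum>u\<in>V. p' u) * sqrt (quad_form V M r)"
        using p r P r1 by (intro hom) (auto simp: p'_def)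
      then have "lam + 2 * s * b \<le> lam * ((1 + s)\<^sup>2 * p w + (1 - p w))"
        unfolding eq scaled[OF w] sum r1 by (simp add: b_def)
      then show "2 * (b - lam * p w) * s \<le> lam * p w * s\<^sup>2"
        by (simp add: algebra_simps power2_eq_square)
    qed
    then show ?thesis by (simp add: b_def)
  qed
  have stat_r: "x w * (\<Sum>v\<in>V. A w v * x v) = lam * (r w * (\<Sum>v\<in>V. M w v * r v))"
    if w: "w \<in> V" for w
  proof -
    define b where "b = x w * (\<Sum>v\<in>V. A w v * x v)"
    define \<rho> where "\<rho> = r w * (\<Sum>v\<in>V. M w v * r v)"
    define \<sigma> where "\<sigma> = (r w)\<^sup>2 * M w w"
    have \<sigma>0: "\<sigma> \<ge> 0" using diag[OF w] by (simp add: \<sigma>_def)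
    have "2 * (b - lam * \<rho>) = 0"
    proof (rule linear_le_quadratic_imp_zero)
      fix s :: real assume s: "\<bar>s\<bar> < 1"
      define t where "t = 2 * s + s\<^sup>2"
      have t1: "1 + t = (1 + s)\<^sup>2" by (simp add: t_def power2_eq_square algebra_simps)
      have k: "1 + t > 0" unfolding t1 using s by (intro zero_less_power) auto
      define r' where "r' = r(w := (1 + t) * r w)"
      have r'0: "r' u \<ge> 0" if "u \<in> V" for u using r[OF that] k by (auto simp: r'_def)
      have Q_eq: "quad_form V M r' = 1 + 2 * t * \<rho> + t\<^sup>2 * \<sigma>"
        unfolding r'_def quad_form_scale_entry[OF V(1) w M] r1 by (simp add: \<rho>_def \<sigma>_def)
      have Q: "quad_form V M r' > 0"
      proof (cases "r w = 0")
        case True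
        then show ?thesis unfolding Q_eq by (simp add: \<rho>_def \<sigma>_def)
      next
        case False
        then have "r' w > 0" using r[OF w] k by (simp add: r'_def)
        then have "0 < r' w * M w w * r' w" using diag[OF w] by simp
        also have "\<dots> \<le> quad_form V M r'"
          by (rule diagonal_le_quad_form[OF V(1) w M0 r'0])
        finally show ?thesis .
      qed
      have eq: "(\<lambda>u. sqrt (p u * r' u)) = x(w := (1 + s) * x w)"
        using s by (auto simp: r'_def x_def real_sqrt_mult t1)
      have "quad_form V A (\<lambda>u. sqrt (p u * r' u)) \<le> lam * (\<Sum>u\<in>V. p u) * sqrt (quad_form V M r')"
        using p r'0 Q p1 by (intro hom) auto
      then have "lam + 2 * s * b \<le> lam * sqrt (1 * quad_form V M r')"
        unfolding eq scaled[OF w] p1 by (simp add: b_def)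
      \<comment> \<open>This replaces the square root by a polynomial and loses nothing to first
        order, because the form equals 1 at \<open>s = 0\<close>.\<close>
      also have "\<dots> \<le> lam * ((1 + quad_form V M r') / 2)"
        using lam0 Q by (intro mult_left_mono arith_geo_mean_sqrt) auto
      finally have "2 * s * b \<le> lam * (t * \<rho> + t\<^sup>2 * \<sigma> / 2)"
        unfolding Q_eq by (simp add: algebra_simps)
      \<comment> \<open>The 9 comes from \<open>t = (2 + s) * s\<close> with \<open>2 + s\<close>
        below 3.\<close>
      moreover have "t\<^sup>2 * (lam * \<sigma> / 2) \<le> 9 * s\<^sup>2 * (lam * \<sigma> / 2)"
      proof (rule mult_right_mono)
        have "(2 + s)\<^sup>2 \<le> 3\<^sup>2" using s by (intro power_mono) auto
        then have "(2 + s)\<^sup>2 * s\<^sup>2 \<le> 3\<^sup>2 * s\<^sup>2" by (intro mult_right_mono) auto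
        moreover have "t = (2 + s) * s" by (simp add: t_def power2_eq_square algebra_simps)
        ultimately show "t\<^sup>2 \<le> 9 * s\<^sup>2" by (simp add: power_mult_distrib)
      qed (use lam0 \<sigma>0 in auto)
      ultimately show "2 * (b - lam * \<rho>) * s \<le> (lam * \<rho> + 9 * (lam * \<sigma> / 2)) * s\<^sup>2"
        by (simp add: algebra_simps t_def)
    qed
    then show ?thesis by (simp add: b_def \<rho>_def)
  qed
  show ?thesis
    by (rule that[OF pr max[folded x_def, folded lam_def] stat_p[unfolded x_def]
          stat_r[unfolded x_def]])
qed

section \<open>The clique bound for matrices with positive diagonal\<close>

lemma clique_bound_positive_diagonal:
  fixes M :: "'a \<Rightarrow> 'a \<Rightarrow> real"
  assumes V: "finite V" "V \<noteq> {}" and loop: "\<And>v. {v} \<notin> E"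
    and M: "psd_matrix_on V M" and M0: "\<And>u v. u \<in> V \<Longrightarrow> v \<in> V \<Longrightarrow> M u v \<ge> 0"
    and diag: "\<And>u. u \<in> V \<Longrightarrow> M u u > 0"
    and pr': "normalized_pair V M p' r'"
  shows "quad_form V (\<lambda>u v. if {u, v} \<in> E then sqrt (M u v) else 0) (\<lambda>u. sqrt (p' u * r' u))
    \<le> 1 - 1 / real (clique_number V E)"
proof -
  define A where "A u v = (if {u, v} \<in> E then sqrt (M u v) else 0)" for u v
  have sym: "symmetric_matrix_on V M" using M by (simp add: psd_matrix_on_iff)
  have A: "symmetric_matrix_on V A"
    using sym by (auto simp: A_def symmetric_matrix_on_def insert_commute)
  have A0: "\<And>u v. u \<in> V \<Longrightarrow> v \<in> V \<Longrightarrow> A u v \<ge> 0" using M0 by (auto simp: A_def)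
  have A_diag: "\<And>u. u \<in> V \<Longrightarrow> A u u = 0" using loop by (simp add: A_def)
  obtain p r :: "'a \<Rightarrow> real" and lam where pr: "normalized_pair V M p r"
    and max: "\<And>p' r'. normalized_pair V M p' r' \<Longrightarrow>
      quad_form V A (\<lambda>u. sqrt (p' u * r' u)) \<le> lam"
    and stat_p: "\<And>u. u \<in> V \<Longrightarrow> sqrt (p u * r u) * (\<Sum>v\<in>V. A u v * sqrt (p v * r v)) = lam * p u"
    and stat_r: "\<And>u. u \<in> V \<Longrightarrow> sqrt (p u * r u) * (\<Sum>v\<in>V. A u v * sqrt (p v * r v))
      = lam * (r u * (\<Sum>v\<in>V. M u v * r v))"
    by (rule quad_form_stationary_max[OF V sym _ _ A])
      (erule (1) M0 | erule diag | erule (1) A0 | erule A_diag | blast)+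
  have p: "\<And>u. u \<in> V \<Longrightarrow> p u \<ge> 0" and r: "\<And>u. u \<in> V \<Longrightarrow> r u \<ge> 0"
    and p1: "(\<Sum>u\<in>V. p u) = 1" and r1: "quad_form V M r = 1"
    using pr by (auto simp: normalized_pair_def)
  have \<omega>: "real (clique_number V E) \<ge> 1" using clique_number_pos[OF V, of E] by simp
  have "lam \<le> 1 - 1 / real (clique_number V E)"
  proof (cases "lam \<le> 0")
    case True
    moreover have "1 / real (clique_number V E) \<le> 1" using \<omega> by simp
    ultimately show ?thesis by linarith
  next
    case False
    then have lam: "lam > 0" by simp
    define W where "W = {u\<in>V. p u > 0}"
    define a where "a u = (\<Sum>v\<in>V. M u v * r v)" for u
    define N where "N u v = M u v / (a u * a v)" for u v
    have WV: "W \<subseteq> V" by (auto simp: W_def)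
    have fW: "finite W" using V WV finite_subset by blast
    \<comment> \<open>Both stationarity conditions have the same left-hand side, and the positive
      factor \<open>lam\<close> cancels.\<close>
    have pra: "p u = r u * a u" if "u \<in> V" for u
      using stat_p[OF that] stat_r[OF that] lam by (simp add: a_def)
    have W_pos: "p u > 0" "r u > 0" "a u > 0" if "u \<in> W" for u
    proof -
      have u: "u \<in> V" "p u > 0" using that by (auto simp: W_def)
      then have "r u * a u > 0" using pra by simp
      then show "p u > 0" "r u > 0" "a u > 0" using u r[OF u(1)] by (auto simp: zero_less_mult_iff)
    qed
    \<comment> \<open>Off the support of \<open>p\<close> also \<open>r\<close> vanishes, since
      \<open>p u = r u * a u\<close> is at least \<open>M u u * (r u)\<^sup>2\<close>.\<close>
    have off_W: "p u = 0" "r u = 0" if "u \<in> V - W" for u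
    proof -
      have u: "u \<in> V" using that by simp
      show p0: "p u = 0" using p[OF u] that by (auto simp: W_def)
      have "M u u * r u \<le> a u" unfolding a_def
        using V u M0 r by (intro member_le_sum[of u V "\<lambda>v. M u v * r v"]) auto
      then have "r u * (M u u * r u) \<le> p u" unfolding pra[OF u] using r[OF u] by (intro mult_left_mono)
      then have "M u u * (r u)\<^sup>2 \<le> 0" using p0 by (simp add: power2_eq_square mult_ac)
      then show "r u = 0" using diag[OF u] by (simp add: mult_le_0_iff)
    qed
    have restrict: "(\<Sum>u\<in>V. h u) = (\<Sum>u\<in>W. h u)" if "\<And>u. u \<in> V - W \<Longrightarrow> h u = 0" for h :: "'a \<Rightarrow> real"
      using that V WV by (intro sum.mono_neutral_right) auto
    have W1: "(\<Sum>u\<in>W. p u) = 1" using restrict[of p] off_W p1 by simp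
    then have "W \<noteq> {}" by auto
    have row: "(\<Sum>v\<in>W. p v * N u v) = 1" if "u \<in> W" for u
    proof -
      have "(\<Sum>v\<in>W. p v * N u v) = (\<Sum>v\<in>W. M u v * r v / a u)"
      proof (rule sum.cong)
        fix v assume v: "v \<in> W"
        then have "p v = r v * a v" using pra WV by blast
        then show "p v * N u v = M u v * r v / a u"
          using W_pos(3)[OF v] W_pos(3)[OF that] by (simp add: N_def)
      qed simp
      also have "\<dots> = (\<Sum>v\<in>W. M u v * r v) / a u" by (simp add: sum_divide_distrib)
      also have "(\<Sum>v\<in>W. M u v * r v) = a u"
        unfolding a_def using off_W by (intro restrict[symmetric]) auto
      finally show ?thesis using W_pos(3)[OF that] by simp
    qed
    \<comment> \<open>Cauchy-Schwarz for \<open>M\<close> between \<open>y = x / a\<close> and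
      \<open>r\<close>: the mixed term is the sum of \<open>x\<close>, and the form at
      \<open>r\<close> is 1.\<close>
    have NJ: "(\<Sum>u\<in>W. x u)\<^sup>2 \<le> (\<Sum>u\<in>W. \<Sum>v\<in>W. x u * N u v * x v)" for x :: "'a \<Rightarrow> real"
    proof -
      define y where "y u = (if u \<in> W then x u / a u else 0)" for u
      have "(\<Sum>u\<in>V. \<Sum>v\<in>V. y u * M u v * r v) = (\<Sum>u\<in>V. y u * a u)"
        by (simp add: a_def sum_distrib_left mult_ac)
      also have "\<dots> = (\<Sum>u\<in>W. y u * a u)" by (rule restrict) (simp add: y_def)
      also have "\<dots> = (\<Sum>u\<in>W. x u)" 
        using W_pos(3) by (intro sum.cong refl) (fastforce simp: y_def)
      finally have l: "(\<Sum>u\<in>V. \<Sum>v\<in>V. y u * M u v * r v) = (\<Sum>u\<in>W. x u)" .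
      have "quad_form V M y = (\<Sum>u\<in>W. \<Sum>v\<in>V. y u * M u v * y v)"
        unfolding quad_form_def by (rule restrict) (simp add: y_def)
      also have "\<dots> = (\<Sum>u\<in>W. \<Sum>v\<in>W. y u * M u v * y v)"
        by (intro sum.cong refl restrict) (simp add: y_def)
      also have "\<dots> = (\<Sum>u\<in>W. \<Sum>v\<in>W. x u * N u v * x v)"
        by (intro sum.cong refl) (simp add: y_def N_def)
      finally show ?thesis using quad_form_Cauchy_Schwarz[OF M, of y r] by (simp add: l r1)
    qed
    \<comment> \<open>Since \<open>p v * r v = (p v)\<^sup>2 / a v\<close> on \<open>W\<close>, the
      factors \<open>sqrt (a u)\<close> and \<open>sqrt (a v)\<close> turn the stationarity equation
      for \<open>M\<close> into one for \<open>N\<close>.\<close>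
    have lam_eq: "(\<Sum>v\<in>W. p v * (if {u, v} \<in> E then sqrt (N u v) else 0)) = lam" if u: "u \<in> W" for u
    proof -
      have root: "sqrt (p v * r v) = p v / sqrt (a v)" if "v \<in> W" for v
      proof -
        have "p v = r v * a v" using pra WV that by blast
        then have "p v * r v = (p v)\<^sup>2 / a v"
          using W_pos(3)[OF that] by (simp add: power2_eq_square)
        then show ?thesis using W_pos[OF that] by (simp add: real_sqrt_divide)
      qed
      have root_N: "sqrt (N u v) = sqrt (M u v) / (sqrt (a u) * sqrt (a v))" for v
        by (simp add: N_def real_sqrt_divide real_sqrt_mult)
      have "lam * p u = sqrt (p u * r u) * (\<Sum>v\<in>V. A u v * sqrt (p v * r v))"
        using stat_p u WV by auto
      also have "(\<Sum>v\<in>V. A u v * sqrt (p v * r v)) = (\<Sum>v\<in>W. A u v * sqrt (p v * r v))"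
        using off_W by (intro restrict) auto
      also have "sqrt (p u * r u) * \<dots>
          = p u * (\<Sum>v\<in>W. p v * (if {u, v} \<in> E then sqrt (N u v) else 0))"
        unfolding sum_distrib_left root[OF u]
        by (intro sum.cong refl) (simp add: root root_N A_def)
      finally show ?thesis using W_pos(1)[OF u] by simp
    qed
    \<comment> \<open>In each row the weights \<open>p v * (1 + N u v)\<close> have total 2, and by
      the arithmetic-geometric mean inequality the neighbours carry at least \<open>2 * lam\<close>
      of it.\<close>
    have "2 * (\<Sum>v\<in>W. p v) \<le> real (clique_number W E) * (2 - 2 * lam)"
    proof (rule clique_averaging[OF fW \<open>W \<noteq> {}\<close> loop, where N = N])
      show N0: "N u v \<ge> 0" if "u \<in> W" "v \<in> W" for u v
      proof -
        have "M u v \<ge> 0" using that WV M0 by blast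
        then show ?thesis using W_pos(3)[OF that(1)] W_pos(3)[OF that(2)] by (simp add: N_def)
      qed
      fix u assume u: "u \<in> W"
      have amgm: "2 * sqrt (N u v) \<le> 1 + N u v" if "v \<in> W" for v
        using arith_geo_mean_sqrt[of 1 "N u v"] N0[OF u that] by simp
      have "2 * lam = (\<Sum>v\<in>W. p v * (if {u, v} \<in> E then 2 * sqrt (N u v) else 0))"
        unfolding lam_eq[OF u, symmetric] sum_distrib_left by (intro sum.cong) auto
      also have "\<dots> \<le> (\<Sum>v\<in>W. p v * (if {u, v} \<in> E then 1 + N u v else 0))"
        using amgm W_pos(1) by (intro sum_mono mult_left_mono) (auto intro: less_imp_le)
      finally have "2 * lam \<le> (\<Sum>v\<in>W. p v * (if {u, v} \<in> E then 1 + N u v else 0))" .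
      moreover have "(\<Sum>v | v \<in> W \<and> {u, v} \<notin> E. p v * (1 + N u v))
          = (\<Sum>v\<in>W. p v * (if {u, v} \<in> E then 0 else 1 + N u v))"
        using fW by (intro sum.mono_neutral_cong_left) auto
      moreover have "(\<Sum>v\<in>W. p v * (if {u, v} \<in> E then 1 + N u v else 0))
          + (\<Sum>v\<in>W. p v * (if {u, v} \<in> E then 0 else 1 + N u v)) = (\<Sum>v\<in>W. p v + p v * N u v)"
        unfolding sum.distrib[symmetric] by (intro sum.cong refl) (auto simp: algebra_simps)
      moreover have "(\<Sum>v\<in>W. p v + p v * N u v) = 2" by (simp add: sum.distrib W1 row[OF u])
      ultimately show "(\<Sum>v | v \<in> W \<and> {u, v} \<notin> E. p v * (1 + N u v)) \<le> 2 - 2 * lam" by linarith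
    qed (use W_pos NJ in auto)
    then have 2: "2 \<le> real (clique_number W E) * (2 - 2 * lam)" by (simp add: W1)
    \<comment> \<open>Positivity of this factor permits replacing the clique number of
      \<open>W\<close> by the larger one of \<open>V\<close>.\<close>
    then have "2 - 2 * lam > 0" by (smt (verit) mult_nonneg_nonpos of_nat_0_le_iff)
    then have "real (clique_number W E) * (2 - 2 * lam) \<le> real (clique_number V E) * (2 - 2 * lam)"
      using clique_number_mono[OF V(1) WV, of E] by (intro mult_right_mono) auto
    then have "1 \<le> real (clique_number V E) * (1 - lam)" using 2 by (simp add: algebra_simps)
    then show ?thesis using \<omega> by (simp add: field_simps)
  qed
  moreover have "quad_form V A (\<lambda>u. sqrt (p' u * r' u)) \<le> lam"
    using pr' by (rule max)
  ultimately show ?thesis unfolding A_def by linarith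
qed

section \<open>From ordered pairs to edges, and removal of the diagonal assumption\<close>

text \<open>Group the ordered pairs by their underlying edge: each fibre consists of the two
  orientations \<open>(a, b)\<close> and \<open>(b, a)\<close>.\<close>

lemma sum_edges_eq_sum_pairs:
  fixes h :: "'a set \<Rightarrow> real"
  assumes G: "finite_simple_graph V E"
  shows "(\<Sum>u\<in>V. \<Sum>v\<in>V. if {u, v} \<in> E then h {u, v} else 0) = 2 * (\<Sum>e\<in>E. h e)"
proof -
  let ?D = "{(u, v). u \<in> V \<and> v \<in> V \<and> {u, v} \<in> E}"
  have V: "finite V" and E: "E \<subseteq> [V]\<^bsup>2\<^esup>" using G by (auto simp: finite_simple_graph_def)
  have D: "finite ?D" by (rule finite_subset[of _ "V \<times> V"]) (use V in auto)
  have fE: "finite E" using E V finite_imp_finite_nsets finite_subset by blast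
  have "(\<Sum>u\<in>V. \<Sum>v\<in>V. if {u, v} \<in> E then h {u, v} else 0)
      = (\<Sum>(u, v)\<in>V \<times> V. if {u, v} \<in> E then h {u, v} else 0)"
    using V by (simp add: sum.cartesian_product)
  also have "\<dots> = (\<Sum>(u, v)\<in>?D. h {u, v})"
    using V by (intro sum.mono_neutral_cong_right) (auto split: if_splits)
  also have "\<dots> = (\<Sum>e\<in>E. \<Sum>(u, v) | (u, v) \<in> ?D \<and> {u, v} = e. h {u, v})"
    using sum.group[OF D fE, of "\<lambda>(u, v). {u, v}" "\<lambda>(u, v). h {u, v}"]
    by (auto simp: case_prod_unfold image_subset_iff)
  also have "\<dots> = (\<Sum>e\<in>E. 2 * h e)"
  proof (rule sum.cong)
    fix e assume e: "e \<in> E"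
    then obtain a b where ab: "e = {a, b}" "a \<noteq> b" "a \<in> V" "b \<in> V"
      using E by (auto simp: nsets_def card_2_iff)
    have "{z. case z of (u, v) \<Rightarrow> (u, v) \<in> ?D \<and> {u, v} = e} = {(a, b), (b, a)}"
      using ab e by (auto simp: doubleton_eq_iff insert_commute)
    then show "(\<Sum>(u, v) | (u, v) \<in> ?D \<and> {u, v} = e. h {u, v}) = 2 * h e"
      using ab by (simp add: insert_commute)
  qed simp
  finally show ?thesis by (simp add: sum_distrib_left)
qed

theorem lemma1p4:
  fixes V :: "'a set" and E :: "'a set set" and M :: "'a \<Rightarrow> 'a \<Rightarrow> real"
  assumes "finite_simple_graph V E"
    and "card V \<ge> 1"
    and "doubly_nonnegative_on V M"
  shows "2 * (\<Sum>e\<in>E. sqrt (edge_entry M e))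
    \<le> (1 - 1 / real (clique_number V E)) * real (card V) * sqrt (\<Sum>u\<in>V. \<Sum>v\<in>V. M u v)"
proof -
  define n where "n = real (card V)"
  define S where "S = (\<Sum>u\<in>V. \<Sum>v\<in>V. M u v)"
  define c where "c = 1 - 1 / real (clique_number V E)"
  define T where "T = 2 * (\<Sum>e\<in>E. sqrt (edge_entry M e))"
  have V: "finite V" "V \<noteq> {}" and n: "n > 0"
    using assms(1,2) by (auto simp: finite_simple_graph_def n_def)
  have loop: "{v} \<notin> E" for v
  proof
    assume "{v} \<in> E"
    then have "{v} \<in> [V]\<^bsup>2\<^esup>" using assms(1) by (auto simp: finite_simple_graph_def)
    then show False by (simp add: nsets_def)
  qed
  have M: "psd_matrix_on V M" and M0: "\<And>u v. u \<in> V \<Longrightarrow> v \<in> V \<Longrightarrow> M u v \<ge> 0"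
    using assms(3) by (auto simp: doubly_nonnegative_on_def)
  have sym: "M u v = M v u" if "u \<in> V" "v \<in> V" for u v
    using M that by (auto simp: psd_matrix_on_def symmetric_matrix_on_def)
  have S0: "S \<ge> 0" unfolding S_def using M0 by (intro sum_nonneg)
  \<comment> \<open>Adding \<open>\<epsilon>\<close> to the diagonal makes it positive and raises
    the total \<open>S\<close> by \<open>n * \<epsilon>\<close>. The edge entries are unchanged
    because there are no loops. The constant functions \<open>1 / n\<close> and \<open>1 / q\<close>
    are then a normalized pair.\<close>
  have bound: "T \<le> c * n * sqrt (S + n * \<epsilon>)" if \<epsilon>: "\<epsilon> > 0" for \<epsilon>
  proof -
    define M' where "M' u v = M u v + (if u = v then \<epsilon> else 0)" for u v
    have form: "quad_form V M' x = quad_form V M x + \<epsilon> * (\<Sum>u\<in>V. (x u)\<^sup>2)" for x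
    proof -
      have "quad_form V M' x
          = (\<Sum>u\<in>V. \<Sum>v\<in>V. x u * M u v * x v + (if u = v then \<epsilon> * (x u)\<^sup>2 else 0))"
        unfolding quad_form_def M'_def
        by (intro sum.cong refl) (auto simp: algebra_simps power2_eq_square)
      then show ?thesis using V(1) by (simp add: quad_form_def sum.distrib sum_distrib_left)
    qed
    have M': "psd_matrix_on V M'"
      unfolding psd_matrix_on_iff form
    proof (intro conjI allI)
      show "symmetric_matrix_on V M'" using sym by (auto simp: symmetric_matrix_on_def M'_def)
      show "0 \<le> quad_form V M x + \<epsilon> * (\<Sum>u\<in>V. (x u)\<^sup>2)" for x
        using M \<epsilon> by (auto simp: psd_matrix_on_iff intro!: add_nonneg_nonneg mult_nonneg_nonneg sum_nonneg)
    qed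
    define q where "q = sqrt (S + n * \<epsilon>)"
    have "S + n * \<epsilon> > 0" using S0 n \<epsilon> by (intro add_nonneg_pos) auto
    then have q: "q > 0" "q\<^sup>2 = S + n * \<epsilon>" by (auto simp: q_def)
    have "quad_form V M' (\<lambda>_. 1 / q * 1) = 1"
    proof -
      have "quad_form V M' (\<lambda>_. 1) = q\<^sup>2"
        unfolding form q by (simp add: quad_form_def S_def n_def)
      then show ?thesis unfolding quad_form_scale using q(1) by (simp add: power_divide)
    qed
    then have pair: "normalized_pair V M' (\<lambda>_. 1 / n) (\<lambda>_. 1 / q)"
      using n q V by (simp add: normalized_pair_def n_def)
    have M'0: "M' u v \<ge> 0" if "u \<in> V" "v \<in> V" for u v using M0[OF that] \<epsilon> by (simp add: M'_def)
    have diag: "M' u u > 0" if "u \<in> V" for u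
      using M0[OF that that] \<epsilon> by (simp add: M'_def add_nonneg_pos)
    have "T = (\<Sum>u\<in>V. \<Sum>v\<in>V. if {u, v} \<in> E then sqrt (edge_entry M {u, v}) else 0)"
      unfolding T_def using sum_edges_eq_sum_pairs[OF assms(1), of "\<lambda>e. sqrt (edge_entry M e)"] by simp
    also have "\<dots> = (\<Sum>u\<in>V. \<Sum>v\<in>V. if {u, v} \<in> E then sqrt (M' u v) else 0)"
      using loop by (intro sum.cong refl) (auto simp: edge_entry_eq[of M, OF sym] M'_def)
    also have "\<dots> = quad_form V (\<lambda>u v. if {u, v} \<in> E then sqrt (M' u v) else 0) (\<lambda>_. 1)"
      by (simp add: quad_form_def)
    finally have "T = quad_form V (\<lambda>u v. if {u, v} \<in> E then sqrt (M' u v) else 0) (\<lambda>_. 1)" .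
    moreover have "quad_form V (\<lambda>u v. if {u, v} \<in> E then sqrt (M' u v) else 0)
        (\<lambda>u. sqrt (1 / n * (1 / q)) * 1) \<le> c"
      using clique_bound_positive_diagonal[OF V loop M' M'0 diag pair] by (simp add: c_def)
    ultimately have "(sqrt (1 / n * (1 / q)))\<^sup>2 * T \<le> c" unfolding quad_form_scale by simp
    then have "T / (n * q) \<le> c" using n q by simp
    then have "T \<le> c * n * q" using n q(1) by (simp add: field_simps)
    then show ?thesis by (simp add: q_def)
  qed
  \<comment> \<open>Let \<open>\<epsilon>\<close> tend to 0 from the right; the bound passes to the
    limit by continuity of the square root.\<close>
  have "((\<lambda>\<epsilon>. c * n * sqrt (S + n * \<epsilon>)) \<longlongrightarrow> c * n * sqrt (S + n * 0)) (at_right 0)"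
    by (intro tendsto_intros)
  moreover have "eventually (\<lambda>\<epsilon>. T \<le> c * n * sqrt (S + n * \<epsilon>)) (at_right 0)"
    using bound eventually_at_right_less by (rule eventually_mono[rotated])
  ultimately have "T \<le> c * n * sqrt (S + n * 0)"
    by (rule tendsto_lowerbound) simp
  then show ?thesis by (simp add: T_def c_def n_def S_def)
qed

end
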